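(* Let $a$ and $b$ be positive integers with $\gcd(a,b)=1$ and $b$ odd. If $3 \mid b$ and $4 \nmid a$, then the torsion subgroup of $E_{a,b}(\mathbb{Q})$, where $E_{a,b}$ is the elliptic curve $y^{2} = x^{3} - a^{2}x + b^{2}$, is trivial. Moreover, there exist infinitely many pairs of positive integers $(a,b)$ with $a^{2} = 3b^{2}+1$ such that the Mordell-Weil rank of $E_{a,b}(\mathbb{Q})$ is at least $3$ and $E_{a,b}(\mathbb{Q})_{\mathrm{tors}}$ is trivial.
   Context: For an elliptic curve $E$ over $\mathbb{Q}$, $E(\mathbb{Q}) \cong \mathbb{Z}^r \oplus E(\mathbb{Q})_{\mathrm{tors}}$ by the Mordell-Weil theorem; $r$ is the Mordell-Weil rank and $E(\mathbb{Q})_{\mathrm{tors}}$ the torsion subgroup. *)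

theory Defs
  imports Complex_Main
begin

datatype ec_point = Infty | Pt rat rat

definition on_curve :: "rat \<Rightarrow> rat \<Rightarrow> ec_point \<Rightarrow> bool" where
  "on_curve A B P = (case P of Infty \<Rightarrow> True | Pt x y \<Rightarrow> y^2 = x^3 + A * x + B)"

definition ec_add :: "rat \<Rightarrow> ec_point \<Rightarrow> ec_point \<Rightarrow> ec_point" where
  "ec_add A P Q = (case P of Infty \<Rightarrow> Q | Pt x1 y1 \<Rightarrow>
     (case Q of Infty \<Rightarrow> P | Pt x2 y2 \<Rightarrow>
       (if x1 = x2 \<and> y1 = - y2 then Infty
        else let l = (if x1 = x2 then (3 * x1^2 + A) / (2 * y1) else (y2 - y1) / (x2 - x1));
                 x3 = l^2 - x1 - x2
             in Pt x3 (l * (x1 - x3) - y1))))"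

definition ec_neg :: "ec_point \<Rightarrow> ec_point" where
  "ec_neg P = (case P of Infty \<Rightarrow> Infty | Pt x y \<Rightarrow> Pt x (- y))"

fun ec_nmul :: "rat \<Rightarrow> nat \<Rightarrow> ec_point \<Rightarrow> ec_point" where
  "ec_nmul A 0 P = Infty"
| "ec_nmul A (Suc n) P = ec_add A P (ec_nmul A n P)"

definition ec_zmul :: "rat \<Rightarrow> int \<Rightarrow> ec_point \<Rightarrow> ec_point" where
  "ec_zmul A k P = (if k \<ge> 0 then ec_nmul A (nat k) P else ec_neg (ec_nmul A (nat (- k)) P))"

definition torsion_trivial :: "rat \<Rightarrow> rat \<Rightarrow> bool" where
  "torsion_trivial A B = (\<forall>P. on_curve A B P \<and> (\<exists>n>0. ec_nmul A n P = Infty) \<longrightarrow> P = Infty)"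

text \<open>Mordell-Weil rank at least r: there are r rational points which are
Z-linearly independent (only the trivial integer combination gives O).
Since E(Q) = Z^rank + finite, this is equivalent to rank \<ge> r.\<close>
definition rank_at_least :: "rat \<Rightarrow> rat \<Rightarrow> nat \<Rightarrow> bool" where
  "rank_at_least A B r = (\<exists>Ps :: ec_point list. length Ps = r \<and> (\<forall>P\<in>set Ps. on_curve A B P) \<and>
     (\<forall>cs :: int list. length cs = r \<longrightarrow>
        foldr (ec_add A) (map2 (ec_zmul A) cs Ps) Infty = Infty \<longrightarrow> (\<forall>c\<in>set cs. c = 0)))"

abbreviation Eab_A :: "int \<Rightarrow> rat" where "Eab_A a \<equiv> - ((of_int a)^2)"
abbreviation Eab_B :: "int \<Rightarrow> rat" where "Eab_B b \<equiv> ((of_int b)^2)"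

end

theory Submission
  imports Defs "HOL-Algebra.Group" "HOL-Computational_Algebra.Nth_Powers"
begin

text \<open>
  Modulo 3 the curve is \<open>y\<^sup>2 = x\<^sup>3 - x\<close>, whose group of points is killed by 2; so the double of every
  rational point has 3 in the denominator of its abscissa. Tripling such a point multiplies the
  denominator by 9 up to units, so its multiples by powers of 3 are pairwise distinct and it is not
  torsion. Hence torsion points have order two, and a root of the cubic is excluded modulo 8.

  If \<open>a\<^sup>2 = 3 b\<^sup>2 + 1\<close>, the points \<open>P = (0, b)\<close>, \<open>Q = (a, b)\<close> and \<open>R = (-1, 2b)\<close> lie on the curve. As
  there is no 2-torsion, they are independent as soon as no nonempty subset of them sums to a double.
  For \<open>a \<equiv> 2\<close> and \<open>b \<equiv> 0\<close> modulo 3, all these sums except \<open>Q + R\<close> are integral at 3, whereas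
  doubles are not; and \<open>Q + R\<close> has negative abscissa, whereas doubles have a positive one.
\<close>

section \<open>The group law on a cubic without rational roots\<close>

text \<open>A rational cubic with a repeated root has a rational root, so the hypothesis gives
  nonsingularity. It also rules out points with \<open>y = 0\<close>, so the tangent slope never
  divides by zero.\<close>

locale curve_no_root =
  fixes A B :: rat
  assumes no_root: "x ^ 3 + A * x + B \<noteq> 0"
begin

lemma on_curve_Pt: "on_curve A B (Pt x y) \<longleftrightarrow> y\<^sup>2 = x ^ 3 + A * x + B"
  by (simp add: on_curve_def)

lemma y_nonzero: "on_curve A B (Pt x y) \<Longrightarrow> y \<noteq> 0"
  using no_root[of x] by (auto simp: on_curve_Pt)

lemma y_cases:
  assumes "on_curve A B (Pt x y)" "on_curve A B (Pt x y')"
  shows "y' = y \<or> y' = - y"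
  using assms by (simp add: on_curve_Pt) (metis power2_eq_iff)

text \<open>The second equation follows from the first if \<open>x1 \<noteq> x2\<close> and is the tangent condition if the
  points coincide, so that chords and tangents need no separate treatment.\<close>

definition slope :: "rat \<Rightarrow> rat \<Rightarrow> rat \<Rightarrow> rat \<Rightarrow> rat \<Rightarrow> bool" where
  "slope x1 y1 x2 y2 l \<longleftrightarrow> y2 - y1 = l * (x2 - x1) \<and> l * (y1 + y2) = x1\<^sup>2 + x1 * x2 + x2\<^sup>2 + A"

lemma slope_sym: "slope x1 y1 x2 y2 l \<Longrightarrow> slope x2 y2 x1 y1 l"
  unfolding slope_def by (auto simp: algebra_simps)

text \<open>Subtracting the curve equations gives \<open>(y2 - y1) * (y1 + y2)\<close> as a multiple
  of \<open>x2 - x1\<close>; for distinct abscissas that factor cancels.\<close>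

lemma slopeI:
  assumes "on_curve A B (Pt x1 y1)" "on_curve A B (Pt x2 y2)"
    and "y2 - y1 = l * (x2 - x1)" "x1 \<noteq> x2"
  shows "slope x1 y1 x2 y2 l"
proof -
  have "(x2 - x1) * (l * (y1 + y2)) = (y2 - y1) * (y1 + y2)"
    using assms(3) by simp
  also have "\<dots> = (x2 - x1) * (x1\<^sup>2 + x1 * x2 + x2\<^sup>2 + A)"
    using assms(1,2) unfolding on_curve_Pt by algebra
  finally show ?thesis
    using assms(3,4) by (simp add: slope_def)
qed

lemma ec_add_slope:
  assumes "on_curve A B (Pt x1 y1)" "on_curve A B (Pt x2 y2)"
    and "slope x1 y1 x2 y2 l" and "\<not> (x1 = x2 \<and> y1 = - y2)"
  shows "ec_add A (Pt x1 y1) (Pt x2 y2) =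
    Pt (l\<^sup>2 - x1 - x2) (l * (x1 - (l\<^sup>2 - x1 - x2)) - y1)"
proof -
  have "l = (if x1 = x2 then (3 * x1\<^sup>2 + A) / (2 * y1) else (y2 - y1) / (x2 - x1))"
  proof (cases "x1 = x2")
    case True
    then have "y2 = y1"
      using y_cases[of x1 y1 y2] assms by auto
    then show ?thesis
      using True assms(3) y_nonzero[OF assms(1)]
      by (simp add: slope_def field_simps power2_eq_square)
  next
    case False
    then show ?thesis
      using assms(3) by (simp add: slope_def)
  qed
  then show ?thesis
    using assms(4) by (simp add: ec_add_def Let_def)
qed

lemma slope_exists:
  assumes "on_curve A B (Pt x1 y1)" "on_curve A B (Pt x2 y2)" "\<not> (x1 = x2 \<and> y1 = - y2)"
  obtains l where "slope x1 y1 x2 y2 l"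
proof (cases "x1 = x2")
  case True
  then have "y2 = y1"
    using y_cases[of x1 y1 y2] assms by auto
  then have "slope x1 y1 x2 y2 ((3 * x1\<^sup>2 + A) / (2 * y1))"
    using True y_nonzero[OF assms(1)] by (simp add: slope_def field_simps power2_eq_square)
  then show ?thesis using that by blast
next
  case False
  then show ?thesis
    using that slopeI[OF assms(1,2), of "(y2 - y1) / (x2 - x1)"] by simp
qed

text \<open>Substituting the line into the curve equation leaves a monic cubic in x whose roots sum
  to \<open>l\<^sup>2\<close>. The two equations of \<open>slope\<close> make \<open>x1\<close> and
  \<open>x2\<close> roots of it, counted twice if they coincide.\<close>

lemma third_point_on_curve:
  assumes "on_curve A B (Pt x1 y1)" "slope x1 y1 x2 y2 l"
  shows "on_curve A B (Pt (l\<^sup>2 - x1 - x2) (l * (x1 - (l\<^sup>2 - x1 - x2)) - y1))"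
  using assms unfolding on_curve_Pt slope_def by algebra

lemma ec_add_Infty [simp]: "ec_add A Infty P = P" "ec_add A P Infty = P"
  by (auto simp: ec_add_def split: ec_point.split)

lemma ec_add_opposite [simp]: "ec_add A (Pt x (- y)) (Pt x y) = Infty" "ec_add A (Pt x y) (Pt x (- y)) = Infty"
  by (auto simp: ec_add_def)

lemma on_curve_Infty [simp]: "on_curve A B Infty"
  by (simp add: on_curve_def)

lemma on_curve_neg: "on_curve A B (Pt x (- y)) \<longleftrightarrow> on_curve A B (Pt x y)"
  by (simp add: on_curve_Pt)

lemma ec_add_closed:
  assumes "on_curve A B P" "on_curve A B Q"
  shows "on_curve A B (ec_add A P Q)"
proof (cases P; cases Q)
  fix x1 y1 x2 y2 assume [simp]: "P = Pt x1 y1" "Q = Pt x2 y2"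
  show ?thesis
  proof (cases "x1 = x2 \<and> y1 = - y2")
    case False
    then obtain l where "slope x1 y1 x2 y2 l"
      using slope_exists assms by (metis \<open>P = Pt x1 y1\<close> \<open>Q = Pt x2 y2\<close>)
    then show ?thesis
      using ec_add_slope[of x1 y1 x2 y2 l] third_point_on_curve[of x1 y1 x2 y2 l] assms False by simp
  qed auto
qed (use assms in auto)

lemma ec_add_commute:
  assumes "on_curve A B P" "on_curve A B Q"
  shows "ec_add A P Q = ec_add A Q P"
proof (cases P; cases Q)
  fix x1 y1 x2 y2 assume [simp]: "P = Pt x1 y1" "Q = Pt x2 y2"
  show ?thesis
  proof (cases "x1 = x2 \<and> y1 = - y2")
    case False
    then obtain l where l: "slope x1 y1 x2 y2 l"
      using slope_exists assms by (metis \<open>P = Pt x1 y1\<close> \<open>Q = Pt x2 y2\<close>)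
    then have "l * (x1 - (l\<^sup>2 - x1 - x2)) - y1 = l * (x2 - (l\<^sup>2 - x2 - x1)) - y2"
      by (auto simp: slope_def algebra_simps)
    then show ?thesis
      using ec_add_slope[of x1 y1 x2 y2 l] ec_add_slope[of x2 y2 x1 y1 l] slope_sym[OF l] l assms False
      by auto
  qed auto
qed auto

text \<open>The line through \<open>-P\<close> and \<open>P + Q\<close> is the mirror image of the line through \<open>P\<close> and \<open>Q\<close>.\<close>

lemma ec_add_neg_cancel:
  assumes "on_curve A B (Pt x1 y1)" "on_curve A B Q"
  shows "ec_add A (Pt x1 (- y1)) (ec_add A (Pt x1 y1) Q) = Q"
proof (cases Q)
  case (Pt x2 y2)
  show ?thesis
  proof (cases "x1 = x2 \<and> y1 = - y2")
    case False
    then obtain l where l: "slope x1 y1 x2 y2 l"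
      using slope_exists assms Pt by metis
    define x3 y3 where "x3 = l\<^sup>2 - x1 - x2" and "y3 = l * (x1 - x3) - y1"
    have sum: "ec_add A (Pt x1 y1) Q = Pt x3 y3"
      using ec_add_slope[of x1 y1 x2 y2 l] l assms False Pt by (simp add: x3_def y3_def)
    have on3: "on_curve A B (Pt x3 y3)"
      using third_point_on_curve[OF assms(1) l] by (simp add: x3_def y3_def)
    have eq2: "y2 = y1 + l * (x2 - x1)"
      using l by (simp add: slope_def algebra_simps)
    show ?thesis
    proof (cases "x1 = x3 \<and> y1 = y3")
      case True
      \<comment> \<open>At \<open>x3 = x1\<close> the formula for \<open>y3\<close> reads
        \<open>y3 = - y1\<close>, so \<open>y1 = y3\<close> forces \<open>y1 = 0\<close>.\<close>
      then have "y1 = 0" using y3_def by auto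
      then show ?thesis using y_nonzero[OF assms(1)] by simp
    next
      case False
      have "slope x1 (- y1) x3 y3 (- l)"
        using l unfolding slope_def x3_def y3_def by algebra
      then show ?thesis
        using ec_add_slope[of x1 "- y1" x3 y3 "- l"] assms(1) on3 False sum Pt eq2
        by (simp add: on_curve_neg x3_def algebra_simps)
    qed
  qed (use Pt in auto)
qed simp

text \<open>Let \<open>l\<close> and \<open>n\<close> be the slopes of the lines through \<open>P\<^sub>1, P\<^sub>2\<close> and through \<open>P\<^sub>2, P\<^sub>3\<close>, and put
  \<open>g = (x\<^sub>3 - x\<^sub>1) / (l - n)\<close>. Then the line through \<open>P\<^sub>1 + P\<^sub>2\<close> and \<open>P\<^sub>3\<close> has slope \<open>- (l + g)\<close>.\<close>

lemma slope_of_sum: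
  assumes on: "on_curve A B (Pt x1 y1)" "on_curve A B (Pt x2 y2)" "on_curve A B (Pt x3 y3)"
    and l: "slope x1 y1 x2 y2 l" and n: "slope x2 y2 x3 y3 n"
    and g: "g * (l - n) = x3 - x1" and ne: "l \<noteq> n"
    and x4: "x4 = l\<^sup>2 - x1 - x2" and y4: "y4 = l * (x1 - x4) - y1"
  shows "slope x4 y4 x3 y3 (- (l + g))" "\<not> (x4 = x3 \<and> y4 = - y3)"
proof -
  have on4: "on_curve A B (Pt x4 y4)"
    using third_point_on_curve[OF on(1) l] by (simp add: x4 y4)
  have "(l - n) * (y3 - y4) = (l - n) * (- (l + g) * (x3 - x4))"
    using l n g unfolding slope_def x4 y4 by algebra
  then have 1: "y3 - y4 = - (l + g) * (x3 - x4)"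
    using ne by simp
  then show "\<not> (x4 = x3 \<and> y4 = - y3)"
    using y_nonzero[OF on(3)] by auto
  show "slope x4 y4 x3 y3 (- (l + g))"
  proof (cases "x4 = x3")
    case False
    then show ?thesis using slopeI[OF on4 on(3) 1] by simp
  next
    \<comment> \<open>Now P1 + P2 = P3, so the line of slope \<open>l\<close> also passes through
      -P3. Only the tangent condition at P3 remains, and it comes from \<open>sum\<close>,
      \<open>diff\<close> and \<open>l\<^sup>2 = x1 + x2 + x3\<close>.\<close>
    case True
    with 1 have "y4 = y3" by simp
    moreover note l n y4 True
    ultimately have sum: "y2 + y3 = - l * (x3 - x2)" and diff: "y3 - y2 = n * (x3 - x2)"
      by (auto simp: slope_def algebra_simps)
    then have "2 * y3 = (n - l) * (x3 - x2)"
      by (simp add: algebra_simps)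
    then have "- (l + g) * (y4 + y3) = (l * (l - n) + (x3 - x1)) * (x3 - x2)"
      using \<open>y4 = y3\<close> g by algebra
    moreover have "- n * l * (x3 - x2) = x2\<^sup>2 + x2 * x3 + x3\<^sup>2 + A"
      using n sum by (simp add: slope_def)
    moreover have "l\<^sup>2 = x1 + x2 + x3"
      using True x4 by simp
    ultimately have "- (l + g) * (y4 + y3) = x4\<^sup>2 + x4 * x3 + x3\<^sup>2 + A"
      using True by algebra
    with 1 show ?thesis by (simp add: slope_def)
  qed
qed

text \<open>For \<open>l \<noteq> n\<close>, exchanging P1 with P3 swaps \<open>l\<close> and
  \<open>n\<close> but keeps \<open>g\<close>, so the two final additions use the slopes
  \<open>- (l + g)\<close> and \<open>- (n + g)\<close>, and the results agree by algebra. For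
  \<open>l = n\<close> the three points are collinear: either P1 = P3 and commutativity suffices, or
  both sides are \<open>Infty\<close>.\<close>

lemma ec_add_assoc_Pt:
  assumes on: "on_curve A B (Pt x1 y1)" "on_curve A B (Pt x2 y2)" "on_curve A B (Pt x3 y3)"
    and ne12: "\<not> (x1 = x2 \<and> y1 = - y2)" and ne23: "\<not> (x2 = x3 \<and> y2 = - y3)"
  shows "ec_add A (ec_add A (Pt x1 y1) (Pt x2 y2)) (Pt x3 y3) =
    ec_add A (Pt x1 y1) (ec_add A (Pt x2 y2) (Pt x3 y3))"
proof -
  obtain l where l: "slope x1 y1 x2 y2 l" using slope_exists[OF on(1,2) ne12] .
  obtain n where n: "slope x2 y2 x3 y3 n" using slope_exists[OF on(2,3) ne23] .
  define x4 y4 where 4: "x4 = l\<^sup>2 - x1 - x2" "y4 = l * (x1 - x4) - y1"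
  define x5 y5 where 5: "x5 = n\<^sup>2 - x3 - x2" "y5 = n * (x3 - x5) - y3"
  have s4: "ec_add A (Pt x1 y1) (Pt x2 y2) = Pt x4 y4"
    using ec_add_slope[OF on(1,2) l ne12] by (simp add: 4)
  have s5: "ec_add A (Pt x2 y2) (Pt x3 y3) = Pt x5 y5"
    using ec_add_slope[OF on(3,2) slope_sym[OF n]] ne23 ec_add_commute[OF on(2,3)] by (auto simp: 5)
  have on4: "on_curve A B (Pt x4 y4)" using ec_add_closed[OF on(1,2)] s4 by simp
  have on5: "on_curve A B (Pt x5 y5)" using ec_add_closed[OF on(2,3)] s5 by simp
  show ?thesis
  proof (cases "l = n")
    case True
    \<comment> \<open>This is the difference of the second equations of the two slopes, with
      \<open>y1 - y3 = l * (x1 - x3)\<close> inserted.\<close>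
    have "(x1 - x3) * (l\<^sup>2 - x1 - x2 - x3) = 0"
      using l n on True unfolding slope_def on_curve_Pt by algebra
    then consider "x1 = x3" | "x4 = x3" "x5 = x1"
      by (auto simp: 4 5 True)
    then show ?thesis
    proof cases
      case 1
      then have "y1 = y3" using l n True by (simp add: slope_def algebra_simps)
      with 1 show ?thesis
        using ec_add_commute[OF on(1,2)] ec_add_commute[OF on4 on(3)] s4 by simp
    next
      case 2
      have "y4 = - y3" "y5 = - y1"
        using l n True unfolding 4(2) 5(2) 2 slope_def by algebra+
      with 2 show ?thesis by (simp add: s4 s5)
    qed
  next
    case False
    define g where "g = (x3 - x1) / (l - n)"
    have g: "g * (l - n) = x3 - x1" "g * (n - l) = x1 - x3"
      using False by (auto simp: g_def field_simps)
    note sl4 = slope_of_sum[OF on l n g(1) False 4]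
    note sl5 = slope_of_sum[OF on(3,2,1) slope_sym[OF n] slope_sym[OF l] g(2) False[symmetric] 5]
    have "ec_add A (Pt x4 y4) (Pt x3 y3) = ec_add A (Pt x5 y5) (Pt x1 y1)"
    proof -
      have x: "(- (l + g))\<^sup>2 - x4 - x3 = (- (n + g))\<^sup>2 - x5 - x1"
        using g unfolding 4(1) 5(1) by algebra
      have y: "- (l + g) * (x3 - X) - y3 = - (n + g) * (x1 - X) - y1"
        if "X = (- (l + g))\<^sup>2 - x4 - x3" for X
        using g l n that unfolding 4(1) slope_def by algebra
      define X where "X = (- (l + g))\<^sup>2 - x4 - x3"
      have X: "X = (- (l + g))\<^sup>2 - x3 - x4" "X = (- (n + g))\<^sup>2 - x1 - x5"
        using x by (simp_all add: X_def)
      have "ec_add A (Pt x4 y4) (Pt x3 y3) = Pt X (- (l + g) * (x3 - X) - y3)"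
        using ec_add_slope[OF on(3) on4 slope_sym[OF sl4(1)], folded X(1)]
          ec_add_commute[OF on4 on(3)] sl4(2) by auto
      moreover have "ec_add A (Pt x5 y5) (Pt x1 y1) = Pt X (- (n + g) * (x1 - X) - y1)"
        using ec_add_slope[OF on(1) on5 slope_sym[OF sl5(1)], folded X(2)]
          ec_add_commute[OF on5 on(1)] sl5(2) by auto
      ultimately show ?thesis using y[OF X_def] by simp
    qed
    then show ?thesis
      using s4 s5 ec_add_commute[OF on5 on(1)] by simp
  qed
qed

lemma ec_add_assoc:
  assumes "on_curve A B P" "on_curve A B Q" "on_curve A B R"
  shows "ec_add A (ec_add A P Q) R = ec_add A P (ec_add A Q R)"
proof (cases P; cases Q; cases R)
  fix x1 y1 x2 y2 x3 y3
  assume [simp]: "P = Pt x1 y1" "Q = Pt x2 y2" "R = Pt x3 y3"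
  consider "x1 = x2 \<and> y1 = - y2" | "x2 = x3 \<and> y2 = - y3" 
    | "\<not> (x1 = x2 \<and> y1 = - y2)" "\<not> (x2 = x3 \<and> y2 = - y3)" by blast
  then show ?thesis
  proof cases
    case 1
    then show ?thesis using ec_add_neg_cancel[of x2 y2 R] assms by simp
  next
    case 2
    have "ec_add A (ec_add A P Q) R = ec_add A (Pt x2 (- y2)) (ec_add A (Pt x2 y2) P)"
      using 2 assms ec_add_commute[of P Q] ec_add_commute[of "ec_add A P Q" R] ec_add_closed[of P Q]
      by simp
    then show ?thesis using ec_add_neg_cancel[of x2 y2 P] assms 2 by simp
  next
    case 3
    then show ?thesis using ec_add_assoc_Pt assms by simp
  qed
qed auto

section \<open>The curve as an abelian group\<close>

abbreviation EC :: "ec_point monoid" where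
  "EC \<equiv> \<lparr>carrier = {P. on_curve A B P}, monoid.mult = ec_add A, one = Infty\<rparr>"

lemma on_curve_ec_neg: "on_curve A B P \<Longrightarrow> on_curve A B (ec_neg P)"
  by (cases P) (auto simp: ec_neg_def on_curve_neg)

lemma ec_add_ec_neg: "ec_add A (ec_neg P) P = Infty"
  by (cases P) (auto simp: ec_neg_def)

sublocale EC: comm_group EC
proof (rule comm_groupI)
  fix P assume "P \<in> carrier EC"
  then show "\<exists>Q\<in>carrier EC. Q \<otimes>\<^bsub>EC\<^esub> P = \<one>\<^bsub>EC\<^esub>"
    using on_curve_ec_neg ec_add_ec_neg by auto
qed (auto simp: ec_add_closed ec_add_assoc intro: ec_add_commute)

lemma ec_nmul_eq_pow:
  assumes "on_curve A B P"
  shows "ec_nmul A n P = P [^]\<^bsub>EC\<^esub> n"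
proof (induction n)
  case (Suc n)
  then show ?case
    using EC.nat_pow_closed[of P n] assms EC.m_comm[of P "P [^]\<^bsub>EC\<^esub> n"] by simp
qed simp

lemma ec_zmul_eq_pow:
  assumes "on_curve A B P"
  shows "ec_zmul A k P = P [^]\<^bsub>EC\<^esub> k"
proof -
  have "ec_neg Q = inv\<^bsub>EC\<^esub> Q" if "on_curve A B Q" for Q
    using that EC.inv_equality[of "ec_neg Q" Q] ec_add_ec_neg on_curve_ec_neg by simp
  moreover have "on_curve A B (P [^]\<^bsub>EC\<^esub> nat (- k))"
    using EC.nat_pow_closed[of P "nat (- k)"] assms by simp
  ultimately show ?thesis
    unfolding ec_zmul_def int_pow_def2 ec_nmul_eq_pow[OF assms] by (metis not_less)
qed

section \<open>Abscissas of doubles and triples\<close>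

lemma ec_double:
  assumes "on_curve A B (Pt x y)"
  shows "\<exists>y'. ec_add A (Pt x y) (Pt x y) = Pt ((x ^ 4 - 2 * A * x\<^sup>2 - 8 * B * x + A\<^sup>2) / (4 * (x ^ 3 + A * x + B))) y'"
proof -
  have y: "y \<noteq> 0" using y_nonzero[OF assms] .
  have "((3 * x\<^sup>2 + A) / (2 * y))\<^sup>2 - x - x = ((3 * x\<^sup>2 + A)\<^sup>2 - 8 * x * y\<^sup>2) / (4 * y\<^sup>2)"
    using y by (simp add: field_simps power2_eq_square)
  also have "(3 * x\<^sup>2 + A)\<^sup>2 - 8 * x * y\<^sup>2 = x ^ 4 - 2 * A * x\<^sup>2 - 8 * B * x + A\<^sup>2"
    using assms unfolding on_curve_Pt by algebra
  finally show ?thesis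
    using assms y by (auto simp: ec_add_def Let_def on_curve_Pt)
qed

lemma no_two_torsion:
  assumes "on_curve A B P" "ec_add A P P = Infty"
  shows "P = Infty"
proof (cases P)
  case (Pt x y)
  then show ?thesis using ec_double[of x y] assms by auto
qed

text \<open>\<open>\<psi>\<close> is the third division polynomial. It equals
  \<open>4 * y\<^sup>2 * (x - x2)\<close> with \<open>x2\<close> the abscissa of the double, so
  \<open>\<psi> \<noteq> 0\<close> makes the second addition a chord.\<close>

lemma ec_triple:
  fixes x y :: rat
  defines "F \<equiv> x ^ 3 + A * x + B"
    and "\<psi> \<equiv> 3 * x ^ 4 + 6 * A * x\<^sup>2 + 12 * B * x - A\<^sup>2"
  assumes on: "on_curve A B (Pt x y)" and "\<psi> \<noteq> 0"
  shows "\<exists>y'. ec_add A (Pt x y) (ec_add A (Pt x y) (Pt x y)) =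
    Pt ((x * \<psi>\<^sup>2 - 8 * F * (3 * x\<^sup>2 + A) * \<psi> + 64 * F ^ 3) / \<psi>\<^sup>2) y'"
proof -
  have y: "y \<noteq> 0" using y_nonzero[OF on] .
  have F: "F = y\<^sup>2" using on by (simp add: F_def on_curve_Pt)
  define l where "l = (3 * x\<^sup>2 + A) / (2 * y)"
  have l: "2 * y * l = 3 * x\<^sup>2 + A" using y by (simp add: l_def)
  define x2 y2 where "x2 = l\<^sup>2 - x - x" and "y2 = l * (x - x2) - y"
  have dbl: "ec_add A (Pt x y) (Pt x y) = Pt x2 y2"
    using y by (simp add: ec_add_def Let_def x2_def y2_def l_def)
  have d: "4 * y\<^sup>2 * (x2 - x) = - \<psi>"
    using l on unfolding x2_def \<psi>_def on_curve_Pt by algebra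
  then have ne: "x \<noteq> x2" using \<open>\<psi> \<noteq> 0\<close> by auto
  \<comment> \<open>Since \<open>y2 - y = - l * (x2 - x) - 2 * y\<close>, the slope is
    \<open>- l - 2 * y / (x2 - x)\<close>, and \<open>d\<close> replaces \<open>x2 - x\<close> by
    \<open>\<psi>\<close>.\<close>
  have m: "(y2 - y) / (x2 - x) = - l + 8 * y ^ 3 / \<psi>"
  proof -
    have "(y2 - y) * \<psi> = (- l * \<psi> + 8 * y ^ 3) * (x2 - x)"
      using d unfolding y2_def by algebra
    then show ?thesis
      using ne \<open>\<psi> \<noteq> 0\<close> by (simp add: field_simps)
  qed
  have "(- l + 8 * y ^ 3 / \<psi>)\<^sup>2 - x - x2 = (x * \<psi>\<^sup>2 - 8 * F * (3 * x\<^sup>2 + A) * \<psi> + 64 * F ^ 3) / \<psi>\<^sup>2"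
  proof -
    have "(- l + 8 * y ^ 3 / \<psi>)\<^sup>2 - x - x2 = ((- l * \<psi> + 8 * y ^ 3)\<^sup>2 - (x + x2) * \<psi>\<^sup>2) / \<psi>\<^sup>2"
      using \<open>\<psi> \<noteq> 0\<close> by (simp add: field_simps power2_eq_square)
    also have "(- l * \<psi> + 8 * y ^ 3)\<^sup>2 - (x + x2) * \<psi>\<^sup>2 = x * \<psi>\<^sup>2 - 8 * F * (3 * x\<^sup>2 + A) * \<psi> + 64 * F ^ 3"
      using l unfolding F x2_def by algebra
    finally show ?thesis .
  qed
  then show ?thesis
    using ne by (simp add: dbl) (simp add: ec_add_def Let_def m)
qed

end

section \<open>Independence of elements modulo doubles\<close>

text \<open>Descent by halving: reduced modulo 2, a relation exhibits a subsum as a square, so all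
  exponents are even. Without 2-torsion the halved relation holds too, and it is smaller unless all
  exponents vanish.\<close>

lemma (in comm_group) independent_if_subsums_nonsquare:
  fixes i j k :: int
  assumes carr: "x \<in> carrier G" "y \<in> carrier G" "z \<in> carrier G"
    and no_two_torsion: "\<And>u. u \<in> carrier G \<Longrightarrow> u \<otimes> u = \<one> \<Longrightarrow> u = \<one>"
    and nonsquare: "\<And>(i::int) (j::int) (k::int) u. \<lbrakk>{i, j, k} \<subseteq> {0, 1}; \<not> (i = 0 \<and> j = 0 \<and> k = 0); u \<in> carrier G\<rbrakk>
      \<Longrightarrow> x [^] i \<otimes> (y [^] j \<otimes> z [^] k) \<noteq> u \<otimes> u"
    and "x [^] i \<otimes> (y [^] j \<otimes> z [^] k) = \<one>"
  shows "i = 0 \<and> j = 0 \<and> k = 0"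
  using assms(6)
proof (induction "nat (\<bar>i\<bar> + \<bar>j\<bar> + \<bar>k\<bar>)" arbitrary: i j k rule: less_induct)
  case less
  define c where "c i j k = x [^] i \<otimes> (y [^] j \<otimes> z [^] k)" for i j k :: int
  have c_closed: "c i j k \<in> carrier G" for i j k
    using carr by (simp add: c_def)
  have c_add: "c (i + i') (j + j') (k + k') = c i j k \<otimes> c i' j' k'" for i j k i' j' k'
    using carr by (simp add: c_def int_pow_mult m_ac)
  have c_zero: "c 0 0 0 = \<one>" by (simp add: c_def)
  define i2 j2 k2 where 2: "i2 = i div 2" "j2 = j div 2" "k2 = k div 2"
  define e f g where e: "e = i mod 2" "f = j mod 2" "g = k mod 2"
  have split: "i = (i2 + i2) + e" "j = (j2 + j2) + f" "k = (k2 + k2) + g"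
    by (simp_all add: 2 e)
  have rel: "c i2 j2 k2 \<otimes> c i2 j2 k2 \<otimes> c e f g = \<one>"
  proof -
    have "c ((i2 + i2) + e) ((j2 + j2) + f) ((k2 + k2) + g) = \<one>"
      using less.prems unfolding c_def split[symmetric] .
    then show ?thesis by (simp only: c_add)
  qed
  have "c (- i2) (- j2) (- k2) \<otimes> c i2 j2 k2 = \<one>"
    using c_add[of "- i2" i2 "- j2" j2 "- k2" k2] c_zero by simp
  then have "c e f g = (c (- i2) (- j2) (- k2) \<otimes> c i2 j2 k2) \<otimes> (c (- i2) (- j2) (- k2) \<otimes> c i2 j2 k2) \<otimes> c e f g"
    by (simp add: c_closed)
  also have "\<dots> = c (- i2) (- j2) (- k2) \<otimes> c (- i2) (- j2) (- k2) \<otimes> (c i2 j2 k2 \<otimes> c i2 j2 k2 \<otimes> c e f g)"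
    by (simp add: c_closed m_ac)
  finally have square: "c e f g = c (- i2) (- j2) (- k2) \<otimes> c (- i2) (- j2) (- k2)"
    using rel by (simp add: c_closed)
  have efg: "e = 0 \<and> f = 0 \<and> g = 0"
  proof (rule ccontr)
    assume ne: "\<not> ?thesis"
    have "{e, f, g} \<subseteq> {0, 1}" by (auto simp: e)
    from nonsquare[OF this ne c_closed[of "- i2" "- j2" "- k2"]] show False
      using square by (simp only: c_def[of e f g])
  qed
  then have "c i2 j2 k2 \<otimes> c i2 j2 k2 = \<one>"
    using rel by (simp add: c_zero c_closed)
  then have c2: "c i2 j2 k2 = \<one>"
    using no_two_torsion[OF c_closed] by blast
  show ?case
  proof (rule ccontr)
    assume ne: "\<not> ?thesis"
    have "i = 2 * i2" "j = 2 * j2" "k = 2 * k2" using split efg by simp_all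
    with ne have "nat (\<bar>i2\<bar> + \<bar>j2\<bar> + \<bar>k2\<bar>) < nat (\<bar>i\<bar> + \<bar>j\<bar> + \<bar>k\<bar>)" by linarith
    then have "i2 = 0 \<and> j2 = 0 \<and> k2 = 0"
      using less.hyps c2 unfolding c_def by blast
    with ne \<open>i = 2 * i2\<close> \<open>j = 2 * j2\<close> \<open>k = 2 * k2\<close> show False by simp
  qed
qed

section \<open>Reduction modulo 3\<close>

text \<open>The 3-adic valuation of \<open>x\<close> is \<open>-m\<close>.\<close>

definition pole3 :: "nat \<Rightarrow> rat \<Rightarrow> bool" where
  "pole3 m x \<longleftrightarrow> (\<exists>p r :: int. \<not> 3 dvd p \<and> \<not> 3 dvd r \<and> x = of_int p / of_int (3 ^ m * r))"

lemma prime_3_int: "prime (3 :: int)"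
  by simp

lemma pole3_unique_aux:
  assumes "pole3 m x" "pole3 m' x"
  shows "\<not> m < m'"
proof
  assume less: "m < m'"
  obtain p r p' r' :: int where
    pr: "\<not> 3 dvd p" "\<not> 3 dvd r" "x = of_int p / of_int (3 ^ m * r)" and
    pr': "\<not> 3 dvd p'" "\<not> 3 dvd r'" "x = of_int p' / of_int (3 ^ m' * r')"
    using assms unfolding pole3_def by metis
  have "r \<noteq> 0" "r' \<noteq> 0" using pr pr' by auto
  then have "of_int (p * (3 ^ m' * r')) = (of_int (p' * (3 ^ m * r)) :: rat)"
    using pr(3) pr'(3) by (simp add: field_simps)
  then have eq: "p * (3 ^ m' * r') = p' * (3 ^ m * r)"
    by (simp only: of_int_eq_iff)
  obtain d where "m' = m + Suc d" using less less_iff_Suc_add by auto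
  with eq have "3 ^ m * (3 * (p * 3 ^ d * r')) = 3 ^ m * (p' * r)"
    by (simp add: power_add algebra_simps)
  then have "3 * (p * 3 ^ d * r') = p' * r" by (simp only: mult_cancel_left) simp
  then have "3 dvd p' * r" by (metis dvd_triv_left)
  then show False using pr pr' prime_dvd_mult_iff[OF prime_3_int] by blast
qed

lemma pole3_unique: "pole3 m x \<Longrightarrow> pole3 m' x \<Longrightarrow> m = m'"
  using pole3_unique_aux by (meson nat_neq_iff)

text \<open>The fraction need not be in lowest terms: with \<open>N\<close> prime to 3, the pole
  order is the multiplicity of 3 in \<open>D\<close>.\<close>

lemma pole3_quotient:
  fixes N D :: int
  assumes "3 dvd D" "\<not> 3 dvd N" "D \<noteq> 0"
  obtains m where "m > 0" "pole3 m (of_int N / of_int D)"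
proof -
  obtain r where r: "D = 3 ^ multiplicity 3 D * r" "\<not> 3 dvd r"
    using multiplicity_decompose'[of D 3] assms(3) by auto
  have "multiplicity 3 D > 0"
    using assms(1) r by (metis gr0I mult_1 power_0)
  moreover have "pole3 (multiplicity 3 D) (of_int N / of_int D)"
    unfolding pole3_def using assms(2) r by metis
  ultimately show ?thesis using that by blast
qed

lemma quotient_neq_if_three_dvd_denominator:
  fixes N D N' D' :: int
  assumes "3 dvd D" "\<not> 3 dvd N" "D \<noteq> 0" "\<not> 3 dvd D'"
  shows "of_int N / of_int D \<noteq> (of_int N' / of_int D' :: rat)"
proof
  assume "of_int N / of_int D = (of_int N' / of_int D' :: rat)"
  moreover have "D' \<noteq> 0" using assms by auto
  ultimately have "of_int (N * D') = (of_int (N' * D) :: rat)"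
    using assms(3) by (simp add: field_simps)
  then have "N * D' = N' * D" by (simp only: of_int_eq_iff)
  then have "3 dvd N * D'" using assms(1) by simp
  then show False using assms prime_dvd_mult_iff[OF prime_3_int] by blast
qed

lemma three_dvd_cube_diff: "(3::int) dvd n ^ 3 - n"
proof -
  have "n mod 3 = 0 \<or> n mod 3 = 1 \<or> n mod 3 = 2" by presburger
  then have "n ^ 3 mod 3 = n mod 3"
    by (elim disjE) (simp_all add: power_mod[of n 3, symmetric])
  then show ?thesis by (simp add: mod_eq_dvd_iff)
qed

lemma square_mod_three: "\<not> 3 dvd n \<Longrightarrow> n\<^sup>2 mod 3 = (1::int)"
proof -
  assume "\<not> 3 dvd n"
  then have "n mod 3 = 1 \<or> n mod 3 = 2" by presburger
  then show ?thesis
    by (elim disjE) (simp_all add: power_mod[of n 3, symmetric])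
qed

text \<open>-1 is not a square modulo 3.\<close>

lemma three_dvd_sum_squares:
  fixes u v :: int
  assumes "3 dvd u\<^sup>2 + v\<^sup>2"
  shows "3 dvd u \<and> 3 dvd v"
proof -
  have sq: "n\<^sup>2 mod 3 = (if 3 dvd n then 0 else 1)" for n :: int
    using square_mod_three[of n] by (auto simp: power2_eq_square)
  have "(u\<^sup>2 mod 3 + v\<^sup>2 mod 3) mod 3 = 0" using assms by (simp add: mod_add_eq)
  then show ?thesis by (auto simp: sq split: if_splits)
qed

section \<open>Doubling and tripling 3-adically, and torsion\<close>

locale curve_mod_three =
  fixes a b :: int
  assumes three_dvd_b: "3 dvd b" and not_three_dvd_a: "\<not> 3 dvd a"
    and no_root_ab: "x ^ 3 + Eab_A a * x + Eab_B b \<noteq> 0"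
begin

sublocale curve_no_root "Eab_A a" "Eab_B b"
  using no_root_ab by unfold_locales

text \<open>The denominator vanishes modulo 3 because \<open>x ^ 3 - x\<close> is zero on the field
  with three elements. The numerator is congruent to
  \<open>(p\<^sup>2 + (a * q)\<^sup>2)\<^sup>2\<close>, which vanishes modulo 3 only if 3 divides
  both \<open>p\<close> and \<open>q\<close>.\<close>

lemma double_reduces_to_Infty:
  assumes "on_curve (Eab_A a) (Eab_B b) (Pt x y)"
  obtains N D :: int and y' where "ec_add (Eab_A a) (Pt x y) (Pt x y) = Pt (of_int N / of_int D) y'"
    "3 dvd D" "\<not> 3 dvd N" "D \<noteq> 0"
proof -
  obtain p q where pq: "quotient_of x = (p, q)" by force
  have x: "x = of_int p / of_int q" and q: "q \<noteq> 0" and cop: "coprime p q"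
    using quotient_of_div[OF pq] quotient_of_denom_pos[OF pq] quotient_of_coprime[OF pq] by auto
  \<comment> \<open>\<open>N\<close> and \<open>D\<close> are numerator and denominator of the
    doubling formula at \<open>p / q\<close>, both cleared by \<open>q ^ 4\<close>.\<close>
  define N where "N = (p\<^sup>2 + (a * q)\<^sup>2)\<^sup>2 - 8 * b\<^sup>2 * p * q ^ 3"
  define G where "G = p ^ 3 - a\<^sup>2 * p * q\<^sup>2 + b\<^sup>2 * q ^ 3"
  define D where "D = 4 * q * G"
  have FG: "of_int q ^ 3 * (x ^ 3 + Eab_A a * x + Eab_B b) = of_int G"
    using q by (simp add: x G_def field_simps power2_eq_square power3_eq_cube)
  then have "G \<noteq> 0" using no_root_ab[of x] q by auto
  then have D: "D \<noteq> 0" using q by (simp add: D_def)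
  have "of_int q ^ 4 * (x ^ 4 - 2 * Eab_A a * x\<^sup>2 - 8 * Eab_B b * x + (Eab_A a)\<^sup>2) = of_int N"
    using q by (simp add: x N_def field_simps power2_eq_square power3_eq_cube power4_eq_xxxx)
  then have "x ^ 4 - 2 * Eab_A a * x\<^sup>2 - 8 * Eab_B b * x + (Eab_A a)\<^sup>2 = of_int N / of_int q ^ 4"
    using q by (simp add: nonzero_eq_divide_eq mult.commute)
  moreover have "x ^ 3 + Eab_A a * x + Eab_B b = of_int G / of_int q ^ 3"
    using FG q by (simp add: nonzero_eq_divide_eq mult.commute)
  ultimately have "(x ^ 4 - 2 * Eab_A a * x\<^sup>2 - 8 * Eab_B b * x + (Eab_A a)\<^sup>2) / (4 * (x ^ 3 + Eab_A a * x + Eab_B b))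
      = (of_int N / of_int q ^ 4) / (4 * (of_int G / of_int q ^ 3))"
    by (simp only:)
  also have "\<dots> = of_int N / of_int D"
    using q \<open>G \<noteq> 0\<close> by (simp add: D_def field_simps power3_eq_cube power4_eq_xxxx)
  finally obtain y' where "ec_add (Eab_A a) (Pt x y) (Pt x y) = Pt (of_int N / of_int D) y'"
    using ec_double[OF assms] by auto
  moreover have "3 dvd D"
  proof -
    have "3 dvd a\<^sup>2 - 1" using square_mod_three[OF not_three_dvd_a] by presburger
    \<comment> \<open>Modulo 3, \<open>q * G\<close> is \<open>p ^ 3 * q - p * q ^ 3\<close>; the
      identity splits it into terms each visibly divisible by 3.\<close>
    moreover have "D = 4 * (q * (p ^ 3 - p) - a\<^sup>2 * p * (q ^ 3 - q) - p * q * (a\<^sup>2 - 1) + b * (b * q ^ 4))"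
      unfolding D_def G_def by algebra
    ultimately show ?thesis
      using three_dvd_cube_diff[of p] three_dvd_cube_diff[of q] three_dvd_b
      by (metis dvd_add dvd_diff dvd_mult dvd_mult2)
  qed
  moreover have "\<not> 3 dvd N"
  proof
    assume "3 dvd N"
    moreover have "3 dvd 8 * b\<^sup>2 * p * q ^ 3"
      using three_dvd_b by (simp add: power2_eq_square)
    ultimately have "3 dvd (p\<^sup>2 + (a * q)\<^sup>2)\<^sup>2"
      unfolding N_def by (metis diff_add_cancel dvd_add)
    then have "3 dvd p\<^sup>2 + (a * q)\<^sup>2"
      using prime_dvd_power[OF prime_3_int] by blast
    then have "3 dvd p" "3 dvd a * q" using three_dvd_sum_squares by blast+
    then have "3 dvd p" "3 dvd q"
      using not_three_dvd_a prime_dvd_mult_iff[OF prime_3_int] by blast+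
    then show False using cop by (metis coprime_common_divisor not_prime_unit prime_3_int)
  qed
  ultimately show ?thesis using that D by blast
qed

text \<open>With 3 dividing \<open>q\<close>, the leading term of \<open>\<psi>\<close> dominates,
  so \<open>q ^ 4 * \<psi>\<close> is 3 times a number \<open>u\<close> prime to 3. The abscissa of
  the triple is then \<open>M / (q * (3 * u)\<^sup>2)\<close> with \<open>M\<close> prime to 3,
  which adds exactly two powers of 3.\<close>

lemma triple_raises_pole3:
  assumes on: "on_curve (Eab_A a) (Eab_B b) (Pt x y)" and "pole3 m x" "m > 0"
  obtains x' y' where
    "ec_add (Eab_A a) (Pt x y) (ec_add (Eab_A a) (Pt x y) (Pt x y)) = Pt x' y'" "pole3 (m + 2) x'"
proof -
  obtain p r :: int where p: "\<not> 3 dvd p" and r: "\<not> 3 dvd r" and x: "x = of_int p / of_int (3 ^ m * r)"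
    using \<open>pole3 m x\<close> unfolding pole3_def by metis
  define q where "q = 3 ^ m * r"
  have x: "x = of_int p / of_int q" using x by (simp add: q_def)
  have q: "q \<noteq> 0" using r by (auto simp: q_def)
  have "3 dvd q" using \<open>m > 0\<close> by (cases m) (auto simp: q_def)
  then obtain q' where q': "q = 3 * q'" by blast
  define u where "u = p ^ 4 + q * (4 * b\<^sup>2 * p * q\<^sup>2 - 2 * a\<^sup>2 * p\<^sup>2 * q - a ^ 4 * q\<^sup>2 * q')"
  define G where "G = p ^ 3 + q * (b\<^sup>2 * q\<^sup>2 - a\<^sup>2 * p * q)"
  define M where "M = p * (3 * u)\<^sup>2 - 8 * G * (3 * p\<^sup>2 - a\<^sup>2 * q\<^sup>2) * (3 * u) + 64 * G ^ 3"
  have u: "\<not> 3 dvd u"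
    using p \<open>3 dvd q\<close> prime_dvd_power[OF prime_3_int, of p 4] unfolding u_def
    by (metis dvd_add_left_iff dvd_mult2)
  have G: "\<not> 3 dvd G"
    using p \<open>3 dvd q\<close> prime_dvd_power[OF prime_3_int, of p 3] unfolding G_def
    by (metis dvd_add_left_iff dvd_mult2)
  have M: "\<not> 3 dvd M"
  proof
    assume "3 dvd M"
    \<comment> \<open>The last term is split as
      \<open>64 * G ^ 3 = 63 * G ^ 3 + G ^ 3\<close>.\<close>
    moreover have "M = 3 * (3 * p * u\<^sup>2 - 8 * G * (3 * p\<^sup>2 - a\<^sup>2 * q\<^sup>2) * u + 21 * G ^ 3) + G ^ 3"
      unfolding M_def by algebra
    ultimately have "3 dvd G ^ 3" by (metis dvd_add_right_iff dvd_triv_left)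
    then show False using G prime_dvd_power[OF prime_3_int] by blast
  qed
  define F where "F = x ^ 3 + Eab_A a * x + Eab_B b"
  define \<psi> where "\<psi> = 3 * x ^ 4 + 6 * Eab_A a * x\<^sup>2 + 12 * Eab_B b * x - (Eab_A a)\<^sup>2"
  have px: "x * of_int q = of_int p" using q by (simp add: x)
  have q'_rat: "of_int q = 3 * (of_int q' :: rat)" using q' by simp
  have F: "of_int q ^ 3 * F = of_int G"
    unfolding F_def G_def of_int_add of_int_mult of_int_power of_int_diff of_int_numeral px[symmetric] by algebra
  have \<psi>: "of_int q ^ 4 * \<psi> = 3 * of_int u"
    unfolding \<psi>_def u_def of_int_add of_int_mult of_int_power of_int_diff of_int_numeral px[symmetric] q'_rat
    by algebra
  then have "\<psi> \<noteq> 0" using u by auto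
  then obtain y' where "ec_add (Eab_A a) (Pt x y) (ec_add (Eab_A a) (Pt x y) (Pt x y)) =
    Pt ((x * \<psi>\<^sup>2 - 8 * F * (3 * x\<^sup>2 + Eab_A a) * \<psi> + 64 * F ^ 3) / \<psi>\<^sup>2) y'"
    using ec_triple[OF on] unfolding F_def \<psi>_def by blast
  moreover have "(x * \<psi>\<^sup>2 - 8 * F * (3 * x\<^sup>2 + Eab_A a) * \<psi> + 64 * F ^ 3) / \<psi>\<^sup>2 =
    of_int M / of_int (3 ^ (m + 2) * (r * u\<^sup>2))"
  proof -
    \<comment> \<open>Degree 9 clears every term: \<open>F\<close> needs \<open>q ^ 3\<close>,
      \<open>\<psi>\<close> needs \<open>q ^ 4\<close>, and \<open>x\<close> needs
      \<open>q\<close>.\<close>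
    have "of_int q ^ 9 * (x * \<psi>\<^sup>2 - 8 * F * (3 * x\<^sup>2 + Eab_A a) * \<psi> + 64 * F ^ 3) =
        (x * of_int q) * (of_int q ^ 4 * \<psi>)\<^sup>2 -
        8 * (of_int q ^ 3 * F) * (3 * (x * of_int q)\<^sup>2 + Eab_A a * of_int q ^ 2) * (of_int q ^ 4 * \<psi>) +
        64 * (of_int q ^ 3 * F) ^ 3"
      by algebra
    also have "\<dots> = of_int M"
      unfolding px F \<psi> M_def by simp
    finally have num: "of_int q ^ 9 * (x * \<psi>\<^sup>2 - 8 * F * (3 * x\<^sup>2 + Eab_A a) * \<psi> + 64 * F ^ 3) = of_int M" .
    have "of_int q ^ 9 * \<psi>\<^sup>2 = of_int q * (of_int q ^ 4 * \<psi>)\<^sup>2" by algebra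
    also have "\<dots> = of_int (3 ^ (m + 2) * (r * u\<^sup>2))"
      unfolding \<psi> by (simp add: q_def power_add power2_eq_square)
    finally have den: "of_int q ^ 9 * \<psi>\<^sup>2 = of_int (3 ^ (m + 2) * (r * u\<^sup>2))" .
    show ?thesis
      unfolding num[symmetric] den[symmetric] using q by simp
  qed
  moreover have "\<not> 3 dvd r * u\<^sup>2"
    using r u by (simp add: prime_dvd_mult_iff[OF prime_3_int] prime_dvd_power_iff[OF prime_3_int])
  ultimately show ?thesis
    using that M unfolding pole3_def by metis
qed

lemma pow_three_power_pole3:
  assumes "on_curve (Eab_A a) (Eab_B b) (Pt x y)" "pole3 m x" "m > 0"
  shows "\<exists>x' y'. Pt x y [^]\<^bsub>EC\<^esub> ((3::nat) ^ k) = Pt x' y' \<and> pole3 (m + 2 * k) x'"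
proof (induction k)
  case 0
  then show ?case using assms by simp
next
  case (Suc k)
  let ?R = "Pt x y [^]\<^bsub>EC\<^esub> ((3::nat) ^ k)"
  have on: "Pt x y \<in> carrier EC" using assms by simp
  obtain x' y' where R: "?R = Pt x' y'" "pole3 (m + 2 * k) x'" using Suc by blast
  have "on_curve (Eab_A a) (Eab_B b) (Pt x' y')"
    using EC.nat_pow_closed[OF on, of "3 ^ k"] R by simp
  then obtain x'' y'' where
    "ec_add (Eab_A a) (Pt x' y') (ec_add (Eab_A a) (Pt x' y') (Pt x' y')) = Pt x'' y''" "pole3 (m + 2 * k + 2) x''"
    using triple_raises_pole3[of x' y' "m + 2 * k"] R assms(3) by auto
  moreover have "Pt x y [^]\<^bsub>EC\<^esub> ((3::nat) ^ Suc k) = ?R \<otimes>\<^bsub>EC\<^esub> (?R \<otimes>\<^bsub>EC\<^esub> ?R)"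
  proof -
    have "(3::nat) ^ Suc k = 3 ^ k + (3 ^ k + 3 ^ k)" by simp
    then show ?thesis using on EC.nat_pow_mult EC.nat_pow_closed by metis
  qed
  ultimately show ?case using R by simp
qed

text \<open>The double of an affine point is affine and has a pole at 3. Its multiples by powers of
  3 have pole orders \<open>m + 2 * k\<close>, hence are infinitely many, whereas a torsion point
  has only finitely many multiples.\<close>

lemma torsion_trivial: "torsion_trivial (Eab_A a) (Eab_B b)"
  unfolding torsion_trivial_def
proof (intro allI impI, elim conjE exE, rule ccontr)
  fix P :: ec_point and n :: nat
  assume on: "on_curve (Eab_A a) (Eab_B b) P" and n: "n > 0" "ec_nmul (Eab_A a) n P = Infty" and "P \<noteq> Infty"
  then obtain x y where P: "P = Pt x y" by (cases P) auto
  obtain N D y' where d: "ec_add (Eab_A a) P P = Pt (of_int N / of_int D) y'"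
    and ND: "3 dvd D" "\<not> 3 dvd N" "D \<noteq> 0"
    using double_reduces_to_Infty on P by metis
  obtain m where m: "m > 0" "pole3 m (of_int N / of_int D)" using pole3_quotient[OF ND] .
  define Q where "Q = Pt (of_int N / of_int D) y'"
  have carr: "P \<in> carrier EC" "Q \<in> carrier EC"
    using on ec_add_closed[OF on on] d by (simp_all add: Q_def)
  have "P [^]\<^bsub>EC\<^esub> n = \<one>\<^bsub>EC\<^esub>" using n on ec_nmul_eq_pow by simp
  moreover have "Q = P \<otimes>\<^bsub>EC\<^esub> P" using d by (simp add: Q_def)
  ultimately have Qn: "Q [^]\<^bsub>EC\<^esub> n = \<one>\<^bsub>EC\<^esub>"
    using carr EC.nat_pow_distrib[of P P n] by simp
  have Qmod: "Q [^]\<^bsub>EC\<^esub> i = Q [^]\<^bsub>EC\<^esub> (i mod n)" for i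
  proof -
    have "Q [^]\<^bsub>EC\<^esub> i = Q [^]\<^bsub>EC\<^esub> (n * (i div n) + i mod n)" by simp
    also have "\<dots> = (Q [^]\<^bsub>EC\<^esub> n) [^]\<^bsub>EC\<^esub> (i div n) \<otimes>\<^bsub>EC\<^esub> Q [^]\<^bsub>EC\<^esub> (i mod n)"
      using carr(2) by (metis EC.nat_pow_mult EC.nat_pow_pow)
    also have "\<dots> = Q [^]\<^bsub>EC\<^esub> (i mod n)"
      using carr(2) Qn by (metis EC.l_one EC.nat_pow_closed EC.nat_pow_one)
    finally show ?thesis .
  qed
  have "inj (\<lambda>k::nat. Q [^]\<^bsub>EC\<^esub> ((3::nat) ^ k))"
  proof (rule injI)
    fix k k' :: nat
    assume "Q [^]\<^bsub>EC\<^esub> ((3::nat) ^ k) = Q [^]\<^bsub>EC\<^esub> ((3::nat) ^ k')"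
    moreover obtain x1 y1 where "Q [^]\<^bsub>EC\<^esub> ((3::nat) ^ k) = Pt x1 y1" "pole3 (m + 2 * k) x1"
      using pow_three_power_pole3 carr(2) m unfolding Q_def by (metis mem_Collect_eq partial_object.select_convs(1))
    moreover obtain x2 y2 where "Q [^]\<^bsub>EC\<^esub> ((3::nat) ^ k') = Pt x2 y2" "pole3 (m + 2 * k') x2"
      using pow_three_power_pole3 carr(2) m unfolding Q_def by (metis mem_Collect_eq partial_object.select_convs(1))
    ultimately have "m + 2 * k = m + 2 * k'" using pole3_unique by (metis ec_point.inject)
    then show "k = k'" by simp
  qed
  then have "infinite (range (\<lambda>k::nat. Q [^]\<^bsub>EC\<^esub> ((3::nat) ^ k)))"
    using finite_imageD infinite_UNIV_nat by blast
  moreover have "range (\<lambda>k::nat. Q [^]\<^bsub>EC\<^esub> ((3::nat) ^ k)) \<subseteq> (\<lambda>i. Q [^]\<^bsub>EC\<^esub> i) ` {..<n}"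
  proof (intro image_subsetI)
    fix k :: nat
    have "3 ^ k mod n \<in> {..<n}" using n by simp
    then show "Q [^]\<^bsub>EC\<^esub> ((3::nat) ^ k) \<in> (\<lambda>i. Q [^]\<^bsub>EC\<^esub> i) ` {..<n}"
      using Qmod by blast
  qed
  ultimately show False using finite_subset by blast
qed

end

section \<open>Absence of 2-torsion\<close>

lemma coprime_square_product:
  fixes u v b :: int
  assumes "coprime u v" "u * v = b\<^sup>2"
  obtains s where "u = s\<^sup>2 \<or> u = - s\<^sup>2"
proof -
  have "nat \<bar>u\<bar> * nat \<bar>v\<bar> = (nat \<bar>b\<bar>)\<^sup>2"
    using assms(2) by (metis abs_mult nat_abs_mult_distrib nat_power_eq abs_ge_zero power2_abs abs_power2)
  then have "is_nth_power 2 (nat \<bar>u\<bar> * nat \<bar>v\<bar>)" by simp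
  moreover have "coprime (nat \<bar>u\<bar>) (nat \<bar>v\<bar>)" using assms(1) by simp
  ultimately have "is_nth_power 2 (nat \<bar>u\<bar>)"
    by (simp only: is_nth_power_mult_coprime_nat_iff)
  then obtain t where "nat \<bar>u\<bar> = t\<^sup>2" by (auto elim: is_nth_powerE)
  then have "\<bar>u\<bar> = (int t)\<^sup>2" by (metis abs_ge_zero nat_0_le of_nat_power)
  then show ?thesis using that[of "int t"] by (auto simp: abs_if split: if_splits)
qed

lemma odd_square_mod_8:
  fixes n :: int
  assumes "odd n"
  shows "n\<^sup>2 mod 8 = 1"
proof -
  have "n mod 8 = 1 \<or> n mod 8 = 3 \<or> n mod 8 = 5 \<or> n mod 8 = 7"
    using assms by presburger
  then show ?thesis
    by (elim disjE) (simp_all add: power_mod[of n 8, symmetric])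
qed

text \<open>An integral root \<open>x\<close> satisfies \<open>x (a\<^sup>2 - x\<^sup>2) = b\<^sup>2\<close> with coprime factors, so \<open>x\<close> is a
  square up to sign; but \<open>x\<close> is odd and \<open>a\<^sup>2 \<equiv> 4\<close> modulo 8 forces \<open>x \<equiv> 3\<close> modulo 8.\<close>

lemma no_integral_root:
  fixes a b x :: int
  assumes "coprime a b" "odd b" "\<not> 4 dvd a"
  shows "x * (a\<^sup>2 - x\<^sup>2) \<noteq> b\<^sup>2"
proof
  assume eq: "x * (a\<^sup>2 - x\<^sup>2) = b\<^sup>2"
  have "odd (b\<^sup>2)" using assms by simp
  then have "odd x" "odd (a\<^sup>2 - x\<^sup>2)" unfolding eq[symmetric] by auto
  then have "even a" by simp
  then obtain c where c: "a = 2 * c" by blast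
  then have "odd c" using assms by auto
  have a8: "a\<^sup>2 mod 8 = 4"
    using odd_square_mod_8[OF \<open>odd c\<close>] by (simp add: c power_mult_distrib) presburger
  have "coprime x (a\<^sup>2 - x\<^sup>2)"
  proof (rule coprimeI)
    fix d assume d: "d dvd x" "d dvd a\<^sup>2 - x\<^sup>2"
    then have "d dvd x\<^sup>2" by (simp add: power2_eq_square)
    with d have "d dvd a\<^sup>2" by (metis diff_add_cancel dvd_add)
    moreover have "d dvd b\<^sup>2" using d(1) unfolding eq[symmetric] by simp
    moreover have "coprime (a\<^sup>2) (b\<^sup>2)" using assms(1) by simp
    ultimately show "is_unit d" using coprime_common_divisor by blast
  qed
  then obtain s where s: "x = s\<^sup>2 \<or> x = - s\<^sup>2" using coprime_square_product eq by blast
  then have "odd s" using \<open>odd x\<close> by auto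
  \<comment> \<open>With \<open>a\<^sup>2 - x\<^sup>2\<close> congruent to 3 modulo 8, these
    residues make the product 3 or 5, while \<open>b\<^sup>2\<close> is 1 modulo 8.\<close>
  then have "x mod 8 = 1 \<or> x mod 8 = 7"
    using s odd_square_mod_8[of s] by presburger
  moreover have "x * (a\<^sup>2 - x\<^sup>2) mod 8 = (x mod 8) * ((a\<^sup>2 mod 8 - x\<^sup>2 mod 8) mod 8) mod 8"
    by (simp add: mod_mult_eq mod_diff_eq)
  ultimately show False
    using odd_square_mod_8[OF \<open>odd x\<close>] odd_square_mod_8[OF \<open>odd b\<close>] a8 eq by auto
qed

text \<open>The cubic is monic with integer coefficients, so a rational root is an integer.\<close>

lemma no_rational_root:
  fixes a b :: int and x :: rat
  assumes "coprime a b" "odd b" "\<not> 4 dvd a"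
  shows "x ^ 3 + Eab_A a * x + Eab_B b \<noteq> 0"
proof
  assume root: "x ^ 3 + Eab_A a * x + Eab_B b = 0"
  obtain p q where pq: "quotient_of x = (p, q)" by force
  have x: "x = of_int p / of_int q" and q: "q > 0" and cop: "coprime p q"
    using quotient_of_div[OF pq] quotient_of_denom_pos[OF pq] quotient_of_coprime[OF pq] by auto
  have "of_int q ^ 3 * (x ^ 3 + Eab_A a * x + Eab_B b) = of_int (p ^ 3 + q * (b\<^sup>2 * q\<^sup>2 - a\<^sup>2 * p * q))"
    using q by (simp add: x field_simps power2_eq_square power3_eq_cube)
  then have "of_int (p ^ 3 + q * (b\<^sup>2 * q\<^sup>2 - a\<^sup>2 * p * q)) = (of_int 0 :: rat)"
    using root by simp
  then have eq: "p ^ 3 + q * (b\<^sup>2 * q\<^sup>2 - a\<^sup>2 * p * q) = 0"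
    by (simp only: of_int_eq_iff)
  then have "q dvd p ^ 3" by (metis dvd_add_left_iff dvd_triv_left dvd_0_right)
  moreover have "coprime q (p ^ 3)" using cop by (simp add: coprime_commute)
  ultimately have "is_unit q" by (metis coprime_common_divisor dvd_refl)
  then have "q = 1" using q by simp
  then have "p * (a\<^sup>2 - p\<^sup>2) = b\<^sup>2" using eq by (simp add: algebra_simps power2_eq_square power3_eq_cube)
  then show False using no_integral_root[OF assms] by blast
qed

lemma curve_mod_three_if:
  fixes a b :: int
  assumes "coprime a b" "odd b" "3 dvd b" "\<not> 4 dvd a"
  shows "curve_mod_three a b"
proof
  show "\<not> 3 dvd a"
    using assms(1,3) by (metis coprime_common_divisor not_prime_unit prime_3_int)
qed (use assms no_rational_root in auto)

section \<open>Curves attached to the Pell equation\<close>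

text \<open>The Pell equation only gives \<open>a\<close> up to sign modulo 3. The residue 2 makes
  \<open>a - 1\<close>, the denominator in the abscissa of P + Q + R, prime to 3.\<close>

locale pell_curve = curve_mod_three +
  assumes pell: "a\<^sup>2 = 3 * b\<^sup>2 + 1" and a_pos: "a > 0" and b_pos: "b > 0" and a_mod_3: "a mod 3 = 2"
begin

lemma pell_rat: "(of_int a)\<^sup>2 = 3 * (of_int b)\<^sup>2 + (1 :: rat)"
  using arg_cong[OF pell, of "of_int :: int \<Rightarrow> rat"] by simp

lemma a_ge_rat: "of_int a \<ge> (4 :: rat)"
proof -
  have "b \<ge> 3" using three_dvd_b b_pos zdvd_imp_le by blast
  then have "b * b \<ge> 3 * 3" by (intro mult_mono) auto
  then have "a * a \<ge> 4 * 4" using pell by (simp add: power2_eq_square)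
  then have "a \<ge> 4" using a_pos by (meson mult_strict_mono not_le order_less_imp_le zero_less_numeral)
  then show ?thesis by (metis of_int_le_iff of_int_numeral)
qed

lemma points_on_curve:
  "on_curve (Eab_A a) (Eab_B b) (Pt 0 (of_int b))"
  "on_curve (Eab_A a) (Eab_B b) (Pt (of_int a) (of_int b))"
  "on_curve (Eab_A a) (Eab_B b) (Pt (- 1) (2 * of_int b))"
  unfolding on_curve_Pt using pell_rat by (simp_all add: power2_eq_square power3_eq_cube algebra_simps)

text \<open>With \<open>S = x\<^sup>2 + a\<^sup>2\<close> the numerator is
  \<open>S\<^sup>2 - 8 * b\<^sup>2 * x\<close>. For positive \<open>x\<close>,
  \<open>S \<ge> 2 * a * x \<ge> 8 * x\<close> since \<open>a \<ge> 4\<close>, and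
  \<open>S > b\<^sup>2\<close> by the Pell equation.\<close>

lemma double_x_pos:
  assumes "on_curve (Eab_A a) (Eab_B b) (Pt x y)" "ec_add (Eab_A a) (Pt x y) (Pt x y) = Pt x' y'"
  shows "x' > 0"
proof -
  have "x' = (x ^ 4 - 2 * Eab_A a * x\<^sup>2 - 8 * Eab_B b * x + (Eab_A a)\<^sup>2) / (4 * (x ^ 3 + Eab_A a * x + Eab_B b))"
    using ec_double[OF assms(1)] assms(2) by auto
  also have "\<dots> = ((x\<^sup>2 + (of_int a)\<^sup>2)\<^sup>2 - 8 * (of_int b)\<^sup>2 * x) / (4 * y\<^sup>2)"
  proof -
    have "y\<^sup>2 = x ^ 3 + Eab_A a * x + Eab_B b" using assms(1) by (simp add: on_curve_Pt)
    moreover have "x ^ 4 - 2 * Eab_A a * x\<^sup>2 - 8 * Eab_B b * x + (Eab_A a)\<^sup>2 = (x\<^sup>2 + (of_int a)\<^sup>2)\<^sup>2 - 8 * (of_int b)\<^sup>2 * x"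
      by algebra
    ultimately show ?thesis by (simp only:)
  qed
  finally have x': "x' = ((x\<^sup>2 + (of_int a)\<^sup>2)\<^sup>2 - 8 * (of_int b)\<^sup>2 * x) / (4 * y\<^sup>2)" .
  define S where "S = x\<^sup>2 + (of_int a)\<^sup>2"
  have S: "S > 0" using a_pos by (simp add: S_def add_nonneg_pos)
  have "8 * (of_int b)\<^sup>2 * x < S\<^sup>2"
  proof (cases "x > 0")
    case False
    then have "8 * (of_int b)\<^sup>2 * x \<le> 0" by (simp add: mult_nonneg_nonpos)
    also have "0 < S\<^sup>2" using S by simp
    finally show ?thesis .
  next
    case True
    have "0 \<le> (x - of_int a)\<^sup>2" by simp
    then have "2 * of_int a * x \<le> S" by (simp add: S_def power2_eq_square algebra_simps)
    moreover have "8 * x \<le> 2 * of_int a * x"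
      using True a_ge_rat by simp
    ultimately have "8 * x \<le> S" by (rule order_trans[rotated])
    then have "S * (8 * x) \<le> S * S"
      using S by (intro mult_left_mono) auto
    moreover have "(of_int b)\<^sup>2 * (8 * x) < S * (8 * x)"
      using True by (intro mult_strict_right_mono) (simp_all add: S_def pell_rat add_nonneg_pos add_pos_nonneg)
    ultimately show ?thesis by (simp add: power2_eq_square algebra_simps)
  qed
  moreover have "y \<noteq> 0" using y_nonzero[OF assms(1)] .
  ultimately show ?thesis unfolding x' S_def by simp
qed

lemma not_double_if_integral:
  assumes "on_curve (Eab_A a) (Eab_B b) U" "\<not> 3 dvd D"
  shows "Pt (of_int N / of_int D) y \<noteq> ec_add (Eab_A a) U U"
proof (cases U)
  case (Pt u v)
  then show ?thesis
    using double_reduces_to_Infty[of u v] quotient_neq_if_three_dvd_denominator[OF _ _ _ assms(2)] assms(1)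
    by (metis ec_point.inject)
qed simp

text \<open>Of the seven nonempty subsums, P, Q, R, P + Q and P + R have integral abscissas, and P +
  Q + R has denominator \<open>a - 1\<close>; Q + R is excluded by sign.\<close>

lemma subsums_not_double:
  fixes i j k :: int
  assumes ijk: "{i, j, k} \<subseteq> {0, 1}" "\<not> (i = 0 \<and> j = 0 \<and> k = 0)" and U: "U \<in> carrier EC"
  shows "Pt 0 (of_int b) [^]\<^bsub>EC\<^esub> i \<otimes>\<^bsub>EC\<^esub> (Pt (of_int a) (of_int b) [^]\<^bsub>EC\<^esub> j \<otimes>\<^bsub>EC\<^esub> Pt (- 1) (2 * of_int b) [^]\<^bsub>EC\<^esub> k)
    \<noteq> U \<otimes>\<^bsub>EC\<^esub> U"
proof -
  let ?P = "Pt 0 (of_int b)" and ?Q = "Pt (of_int a) (of_int b)" and ?R = "Pt (- 1) (2 * of_int b)"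
  let ?add = "ec_add (Eab_A a)"
  have onU: "on_curve (Eab_A a) (Eab_B b) U" using U by simp
  note ar = a_ge_rat
  have pow: "X [^]\<^bsub>EC\<^esub> (0::int) = Infty" "on_curve (Eab_A a) (Eab_B b) X \<Longrightarrow> X [^]\<^bsub>EC\<^esub> (1::int) = X" for X
    using EC.int_pow_1[of X] by simp_all
  have integral: "Pt (of_int N) y \<noteq> ?add U U" for N y
    using not_double_if_integral[OF onU, of 1 N y] by simp
  have PR: "?add ?P ?R = Pt (of_int (b\<^sup>2 + 1)) (of_int (b ^ 3))"
    by (simp add: ec_add_def Let_def) (simp add: power2_eq_square power3_eq_cube algebra_simps)
  have PQ: "?add ?P ?Q = Pt (of_int (- a)) (- of_int b)"
    using a_pos by (simp add: ec_add_def)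
  \<comment> \<open>Here \<open>(b / (a + 1))\<^sup>2 = (a - 1) / (3 * (a + 1))\<close> does have 3
    in its denominator, so integrality at 3 gives nothing. Instead this square is below 1, whence
    \<open>x' < 2 - a < 0\<close>.\<close>
  have QR: "?add ?Q ?R \<noteq> ?add U U"
  proof
    assume eq: "?add ?Q ?R = ?add U U"
    obtain x' y' where s: "?add ?Q ?R = Pt x' y'" and x': "x' = (of_int b / (- 1 - of_int a))\<^sup>2 - of_int a + 1"
      using ar by (simp add: ec_add_def Let_def)
    then obtain u v where "U = Pt u v" using eq by (cases U) auto
    then have "x' > 0" using double_x_pos[of u v x' y'] onU eq s by simp
    moreover have "(of_int b / (- 1 - of_int a))\<^sup>2 < (1 :: rat)"
    proof -
      have "(of_int b)\<^sup>2 < 1 + 2 * of_int a + (3 * (of_int b)\<^sup>2 + (1 :: rat))"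
        using ar zero_le_power2[of "of_int b :: rat"] by linarith
      also have "\<dots> = (- 1 - of_int a)\<^sup>2"
        unfolding pell_rat[symmetric] by algebra
      finally show ?thesis using ar by (simp add: power_divide)
    qed
    ultimately show False using x' ar by simp
  qed
  have PQR: "?add ?P (?add ?Q ?R) \<noteq> ?add U U"
  proof -
    have "?add ?P (?add ?Q ?R) = ?add (Pt (of_int (- a)) (- of_int b)) ?R"
      using ec_add_assoc[OF points_on_curve] PQ by simp
    also obtain y' where "\<dots> = Pt ((3 * of_int b / (of_int a - 1))\<^sup>2 + of_int a + 1) y'"
      using ar by (simp add: ec_add_def Let_def)
    \<comment> \<open>By the Pell equation \<open>9 * b\<^sup>2 = 3 * (a - 1) * (a + 1)\<close>, so
      one factor \<open>a - 1\<close> cancels.\<close>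
    also have "(3 * of_int b / (of_int a - 1))\<^sup>2 + of_int a + 1 = of_int ((a + 1) * (a + 2)) / (of_int (a - 1) :: rat)"
    proof -
      define d :: rat where "d = of_int a - 1"
      have d: "d \<noteq> 0" "of_int a = d + 1" using ar by (auto simp: d_def)
      have "9 * (of_int b)\<^sup>2 = 3 * (d + 2) * d"
        using pell_rat unfolding d(2) by algebra
      then have "(3 * of_int b / d)\<^sup>2 = 3 * (d + 2) * d / d\<^sup>2"
        by (simp add: power_divide power_mult_distrib)
      then show ?thesis using d by (simp add: field_simps power2_eq_square)
    qed
    finally have sum: "?add ?P (?add ?Q ?R) = Pt (of_int ((a + 1) * (a + 2)) / of_int (a - 1)) y'" .
    have "\<not> 3 dvd a - 1" using a_mod_3 by presburger
    then show ?thesis unfolding sum by (rule not_double_if_integral[OF onU])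
  qed
  have "i = 0 \<or> i = 1" "j = 0 \<or> j = 1" "k = 0 \<or> k = 1" using ijk(1) by auto
  then show ?thesis
    using ijk(2) integral[of 0] integral[of a] integral[of "- 1"] integral[of "- a"]
      integral[of "b\<^sup>2 + 1"] PQ PR QR PQR
    by (elim disjE) (simp_all add: pow points_on_curve)
qed

lemma rank_ge_3: "rank_at_least (Eab_A a) (Eab_B b) 3"
proof -
  let ?Ps = "[Pt 0 (of_int b), Pt (of_int a) (of_int b), Pt (- 1) (2 * of_int b)]"
  have "\<forall>c\<in>set cs. c = 0"
    if len: "length cs = 3" and sum: "foldr (ec_add (Eab_A a)) (map2 (ec_zmul (Eab_A a)) cs ?Ps) Infty = Infty" for cs :: "int list"
  proof -
    obtain i j k where cs: "cs = [i, j, k]"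
      using len by (auto simp: numeral_3_eq_3 length_Suc_conv)
    have "Pt 0 (of_int b) [^]\<^bsub>EC\<^esub> i \<otimes>\<^bsub>EC\<^esub> (Pt (of_int a) (of_int b) [^]\<^bsub>EC\<^esub> j \<otimes>\<^bsub>EC\<^esub> Pt (- 1) (2 * of_int b) [^]\<^bsub>EC\<^esub> k) = \<one>\<^bsub>EC\<^esub>"
      using sum by (simp add: cs ec_zmul_eq_pow points_on_curve)
    then have "i = 0 \<and> j = 0 \<and> k = 0"
      using EC.independent_if_subsums_nonsquare[OF _ _ _ _ subsums_not_double]
        points_on_curve no_two_torsion by simp
    then show ?thesis by (simp add: cs)
  qed
  then show ?thesis
    unfolding rank_at_least_def using points_on_curve by (intro exI[of _ ?Ps]) auto
qed

end

section \<open>Infinitely many solutions of the Pell equation\<close>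

text \<open>The pairs are the odd powers of \<open>26 + 15 \<surd>3\<close>: multiplying by
  \<open>(26 + 15 \<surd>3)\<^sup>2 = 1351 + 780 \<surd>3\<close> preserves all the congruences.\<close>

fun pell_pair :: "nat \<Rightarrow> int \<times> int" where
  "pell_pair 0 = (26, 15)"
| "pell_pair (Suc n) = (let (a, b) = pell_pair n in (1351 * a + 2340 * b, 780 * a + 1351 * b))"

lemma pell_pair_properties:
  assumes "pell_pair n = (a, b)"
  shows "a > 0 \<and> b > 0 \<and> a\<^sup>2 = 3 * b\<^sup>2 + 1 \<and> odd b \<and> 3 dvd b \<and> a mod 3 = 2"
  using assms
proof (induction n arbitrary: a b)
  case (Suc n)
  obtain a' b' where p: "pell_pair n = (a', b')" by force
  have ab: "a = 1351 * a' + 2340 * b'" "b = 780 * a' + 1351 * b'" using Suc.prems p by auto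
  note IH = Suc.IH[OF p]
  then have "a'\<^sup>2 = 3 * b'\<^sup>2 + 1" by blast
  \<comment> \<open>The multiplier has norm
    \<open>1351\<^sup>2 - 3 * 780\<^sup>2 = 1\<close>.\<close>
  then have "a\<^sup>2 = 3 * b\<^sup>2 + 1" unfolding ab by algebra
  moreover have "odd b" using IH by (simp add: ab)
  \<comment> \<open>The recursion matrix is the identity modulo 3, so both residues persist.\<close>
  moreover have "b = b' + 3 * (260 * a' + 450 * b')" "a = a' + 3 * (450 * a' + 780 * b')"
    by (simp_all add: ab)
  then have "3 dvd b" "a mod 3 = 2" using IH by (metis dvd_add dvd_triv_left, metis mod_mult_self2)
  ultimately show ?case using IH ab by simp
qed auto

lemma inj_pell_pair: "inj pell_pair"
proof -
  have "fst (pell_pair n) < fst (pell_pair (Suc n))" for n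
    using pell_pair_properties[of n] by (cases "pell_pair n") auto
  then have "strict_mono (fst \<circ> pell_pair)"
    by (simp add: strict_mono_Suc_iff)
  then show ?thesis
    using strict_mono_imp_inj_on inj_on_imageI2 by blast
qed

lemma pell_pair_curve:
  assumes "pell_pair n = (a, b)"
  shows "pell_curve a b"
proof -
  note props = pell_pair_properties[OF assms]
  have "coprime a b"
  proof (rule coprimeI)
    fix d assume "d dvd a" "d dvd b"
    then have "d dvd a * a - 3 * b * b" by simp
    also have "a * a - 3 * b * b = 1" using props by (simp add: power2_eq_square)
    finally show "is_unit d" .
  qed
  moreover have "\<not> 4 dvd a"
  proof
    assume "4 dvd a"
    then obtain c where "a = 4 * c" by blast
    then have "16 * c\<^sup>2 = 3 * b\<^sup>2 + 1" using props by (simp add: power_mult_distrib)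
    \<comment> \<open>For odd \<open>b\<close>, \<open>3 * b\<^sup>2 + 1\<close> is 4 modulo 8, but
      \<open>16 * c\<^sup>2\<close> is 0.\<close>
    then show False using odd_square_mod_8[of b] props by presburger
  qed
  ultimately interpret curve_mod_three a b using curve_mod_three_if props by blast
  show ?thesis using props by unfold_locales auto
qed

theorem theorem1p1:
  shows "(\<forall>a b :: int. a > 0 \<and> b > 0 \<and> gcd a b = 1 \<and> odd b \<and> 3 dvd b \<and> \<not> 4 dvd a
            \<longrightarrow> torsion_trivial (Eab_A a) (Eab_B b))
       \<and> infinite {(a :: int, b :: int). a > 0 \<and> b > 0 \<and> a^2 = 3 * b^2 + 1
            \<and> rank_at_least (Eab_A a) (Eab_B b) 3 \<and> torsion_trivial (Eab_A a) (Eab_B b)}"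
    (is "?torsion \<and> infinite ?S")
proof
  show ?torsion
    using curve_mod_three.torsion_trivial curve_mod_three_if by (auto simp: coprime_iff_gcd_eq_1)
  have "range pell_pair \<subseteq> ?S"
  proof (rule image_subsetI)
    fix n
    obtain a b where p: "pell_pair n = (a, b)" by force
    interpret pell_curve a b using pell_pair_curve[OF p] .
    show "pell_pair n \<in> ?S"
      unfolding p using pell_pair_properties[OF p] rank_ge_3 torsion_trivial by simp
  qed
  moreover have "infinite (range pell_pair)"
    using inj_pell_pair finite_imageD infinite_UNIV_nat by blast
  ultimately show "infinite ?S" using finite_subset by blast
qed

end
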